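(* Let $f$ have a zero $\alpha$ of known multiplicity $m\ge 1$, and consider the two-point iterative family $$ \begin{cases} y_k=x_k-m\,\dfrac{f(x_k)}{f'(x_k)},\\[6pt] x_{k+1}=y_k-m\,u_kP(u_k)\,\dfrac{f(x_k)}{f'(x_k)}, \end{cases} \qquad u_k=\Bigl(\frac{f(y_k)}{f(x_k)}\Bigr)^{1/m}\qquad(k=0,1,\ldots), $$ where the weight function $P$ satisfies $P(0)=1$ and $P'(0)=2$. Then the family has order four; explicitly, with $\varepsilon_k=x_k-\alpha$ and $x_k$ sufficiently close to $\alpha$, $$ x_{k+1}-\alpha=\frac{-2m\,C_1C_2+C_1^3\bigl(9+m-P''(0)\bigr)}{2m^3}\,\varepsilon_k^4+O(\varepsilon_k^5), $$ where $C_r=\dfrac{m!}{(m+r)!}\,\dfrac{f^{(m+r)}(\alpha)}{f^{(m)}(\alpha)}$ for $r=1,2$.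
   Context: $f$ is a real function of a real variable, infinitely differentiable near $\alpha$ (or a complex function holomorphic near $\alpha$), with $f(\alpha)=\dots=f^{(m-1)}(\alpha)=0$ and $f^{(m)}(\alpha)\neq 0$. The function $P$ of one variable is smooth near $0$. The initial approximation $x_0$ is assumed sufficiently close to $\alpha$, and the step is considered for $x_k$ with $f(x_k)\neq0$. Meaning of the $m$-th root: write $f(x)=\frac{f^{(m)}(\alpha)}{m!}(x-\alpha)^m h(x)$ with $h(\alpha)=1$, and let $h^{1/m}$ be the smooth $m$-th root near $\alpha$ with $h(\alpha)^{1/m}=1$. Then $$ \Bigl(\frac{f(s)}{f(t)}\Bigr)^{1/m}:=\frac{(s-\alpha)\,h(s)^{1/m}}{(t-\alpha)\,h(t)^{1/m}} , $$ that is, the root of the ratio equals $F(s)/F(t)$, where $F=f^{1/m}$ (up to a constant factor) is the function for which $\alpha$ is a simple zero. "Order four" means $x_{k+1}-\alpha=O(\varepsilon_k^4)$ as $\varepsilon_k\to0$. *)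

theory Defs
  imports "HOL-Complex_Analysis.Complex_Analysis" "HOL-Library.Landau_Symbols"
begin

(* For 'a = real this is C-infinity on a neighbourhood of a; for 'a = complex it amounts to
   being holomorphic near a. *)
definition smooth_near :: "('a::real_normed_field \<Rightarrow> 'a) \<Rightarrow> 'a \<Rightarrow> bool" where
  "smooth_near f a \<longleftrightarrow>
     (\<exists>S. open S \<and> a \<in> S \<and> (\<forall>n. \<forall>x\<in>S. (deriv ^^ n) f field_differentiable at x))"

definition zero_of_multiplicity :: "('a::real_normed_field \<Rightarrow> 'a) \<Rightarrow> 'a \<Rightarrow> nat \<Rightarrow> bool" where
  "zero_of_multiplicity f \<alpha> m \<longleftrightarrow> (\<forall>j<m. (deriv ^^ j) f \<alpha> = 0) \<and> (deriv ^^ m) f \<alpha> \<noteq> 0"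

(* The factor h in f(x) = f^(m)(\<alpha>)/m! (x - \<alpha>)^m h(x), h(\<alpha>) = 1. *)
definition cofactor :: "('a::real_normed_field \<Rightarrow> 'a) \<Rightarrow> 'a \<Rightarrow> nat \<Rightarrow> 'a \<Rightarrow> 'a" where
  "cofactor f \<alpha> m x =
     (if x = \<alpha> then 1 else f x / ((deriv ^^ m) f \<alpha> / fact m * (x - \<alpha>) ^ m))"

(* Only the germ of the root at \<alpha> is determined; the values away from \<alpha> are arbitrary
   and irrelevant for asymptotic statements at \<alpha>. *)
definition smooth_root :: "nat \<Rightarrow> ('a::real_normed_field \<Rightarrow> 'a) \<Rightarrow> 'a \<Rightarrow> 'a \<Rightarrow> 'a" where
  "smooth_root m h \<alpha> =
     (SOME r. smooth_near r \<alpha> \<and> r \<alpha> = 1 \<and> (\<forall>\<^sub>F x in nhds \<alpha>. r x ^ m = h x))"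

(* (f(s)/f(t))^(1/m), read as F(s)/F(t) where F(x) = (x - \<alpha>) h(x)^(1/m) is f^(1/m) up to a
   constant factor; in particular its sign is fixed also for real f and even m. *)
definition root_ratio :: "('a::real_normed_field \<Rightarrow> 'a) \<Rightarrow> 'a \<Rightarrow> nat \<Rightarrow> 'a \<Rightarrow> 'a \<Rightarrow> 'a" where
  "root_ratio f \<alpha> m s t =
     ((s - \<alpha>) * smooth_root m (cofactor f \<alpha> m) \<alpha> s) /
     ((t - \<alpha>) * smooth_root m (cofactor f \<alpha> m) \<alpha> t)"

definition two_point_iteration ::
  "('a::real_normed_field \<Rightarrow> 'a) \<Rightarrow> 'a \<Rightarrow> nat \<Rightarrow> ('a \<Rightarrow> 'a) \<Rightarrow>
   (nat \<Rightarrow> 'a) \<Rightarrow> (nat \<Rightarrow> 'a) \<Rightarrow> (nat \<Rightarrow> 'a) \<Rightarrow> bool" where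
  "two_point_iteration f \<alpha> m P x y u \<longleftrightarrow>
     (\<forall>k. y k = x k - of_nat m * (f (x k) / deriv f (x k)) \<and>
          u k = root_ratio f \<alpha> m (y k) (x k) \<and>
          x (Suc k) = y k - of_nat m * u k * P (u k) * (f (x k) / deriv f (x k)))"

(* The remainder depends on the current iterate only, so the O-bound is uniform in k and in
   the starting point. *)
definition iteration_order ::
  "('a::real_normed_field \<Rightarrow> 'a) \<Rightarrow> 'a \<Rightarrow> nat \<Rightarrow> ('a \<Rightarrow> 'a) \<Rightarrow> nat \<Rightarrow> bool" where
  "iteration_order f \<alpha> m P p \<longleftrightarrow>
     (\<exists>R \<in> O[at \<alpha>](\<lambda>t. (t - \<alpha>) ^ p).
        \<forall>x y u. two_point_iteration f \<alpha> m P x y u \<longrightarrow>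
          (\<forall>k. f (x k) \<noteq> 0 \<longrightarrow> x (Suc k) - \<alpha> = R (x k)))"

definition C_coeff :: "('a::real_normed_field \<Rightarrow> 'a) \<Rightarrow> 'a \<Rightarrow> nat \<Rightarrow> nat \<Rightarrow> 'a" where
  "C_coeff f \<alpha> m r =
     fact m / fact (m + r) * ((deriv ^^ (m + r)) f \<alpha> / (deriv ^^ m) f \<alpha>)"

end

(*
  Put F(x) = (x - alpha) r(x), where r is the smooth m-th root of the cofactor. Then f = c F^m near
  alpha, so m f/f' = F/F' and u = F(y)/F(x): the family is the scheme for simple zeros applied to F.
  Writing r = 1 + a e + b e^2 + ..., its error is a (5 a^2 - b - P''(0) a^2/2) e^4 + O(e^5), and
  comparing coefficients in r^m = h gives C_1 = m a and C_2 = m b + m (m - 1) a^2/2.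
*)
theory Submission
  imports Defs
begin

text \<open>The real and the complex claim are two instances of one argument over a complete normed
  field, so neither Cauchy's theory nor the order of the reals is used. This shapes the two places
  where smoothness is delicate. The quotient of \<open>f\<close> by
  \<open>(x - \<alpha>) ^ m\<close> has a removable singularity at \<open>\<alpha>\<close>; its
  smoothness there comes from an integral over the segment from \<open>\<alpha>\<close> to
  \<open>x\<close>, which makes sense in both fields. The root of that quotient is smooth because it
  solves a first-order linear differential equation. Only after the power of
  \<open>x - \<alpha>\<close> has been divided out can a root be taken: \<open>f\<close> itself
  vanishes at \<open>\<alpha>\<close>, where a root of it would have no reason to be smooth. The
  error of order four needs only expansions of order two, since one factor
  \<open>(x - \<alpha>)^2\<close> is split off exactly before anything is expanded.\<close>

section \<open>Smoothness through families of functions closed under differentiation\<close>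

lemma higher_deriv_closed_family:
  fixes A :: "('a::real_normed_field \<Rightarrow> 'a) set"
  assumes S: "open S"
    and A: "\<And>\<phi>. \<phi> \<in> A \<Longrightarrow> \<exists>\<psi>\<in>A. \<forall>x\<in>S. (\<phi> has_field_derivative \<psi> x) (at x)"
    and \<phi>: "\<phi> \<in> A"
  shows "\<exists>\<psi>\<in>A. \<forall>x\<in>S. (deriv ^^ n) \<phi> x = \<psi> x"
proof (induction n)
  case 0
  then show ?case using \<phi> by auto
next
  case (Suc n)
  then obtain \<psi> where \<psi>: "\<psi> \<in> A" "\<forall>x\<in>S. (deriv ^^ n) \<phi> x = \<psi> x" by blast
  obtain \<theta> where \<theta>: "\<theta> \<in> A" "\<forall>x\<in>S. (\<psi> has_field_derivative \<theta> x) (at x)"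
    using A[OF \<psi>(1)] by blast
  have "((deriv ^^ n) \<phi> has_field_derivative \<theta> x) (at x)" if "x \<in> S" for x
    using has_field_derivative_transform_within_open[of \<psi> "\<theta> x" x S] \<theta>(2) \<psi>(2) S that by auto
  then have "\<forall>x\<in>S. (deriv ^^ Suc n) \<phi> x = \<theta> x"
    by (auto intro: DERIV_imp_deriv)
  with \<theta>(1) show ?case by blast
qed

text \<open>Every iterated derivative agrees on \<open>S\<close> with a member of the family, and
  every member is differentiable on \<open>S\<close>. No formula for the \<open>n\<close>-th
  derivative is needed, which spares Leibniz and chain rule expansions later.\<close>

lemma smooth_near_closed_family:
  fixes A :: "('a::real_normed_field \<Rightarrow> 'a) set"
  assumes S: "open S" "a \<in> S"
    and A: "\<And>\<phi>. \<phi> \<in> A \<Longrightarrow> \<exists>\<psi>\<in>A. \<forall>x\<in>S. (\<phi> has_field_derivative \<psi> x) (at x)"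
    and \<phi>: "\<phi> \<in> A"
  shows "smooth_near \<phi> a"
  unfolding smooth_near_def
proof (intro exI[of _ S] conjI allI ballI S)
  fix n x assume x: "x \<in> S"
  obtain \<psi> where \<psi>: "\<psi> \<in> A" "\<forall>x\<in>S. (deriv ^^ n) \<phi> x = \<psi> x"
    using higher_deriv_closed_family[of S A \<phi> n] S(1) A \<phi> by blast
  obtain \<theta> where "\<forall>x\<in>S. (\<psi> has_field_derivative \<theta> x) (at x)"
    using A[OF \<psi>(1)] by blast
  with \<psi> S(1) x have "((deriv ^^ n) \<phi> has_field_derivative \<theta> x) (at x)"
    using has_field_derivative_transform_within_open[of \<psi> "\<theta> x" x S] by auto
  then show "(deriv ^^ n) \<phi> field_differentiable at x"
    by (auto simp: field_differentiable_def)
qed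

lemma smooth_near_ball:
  fixes g :: "'a::real_normed_field \<Rightarrow> 'a"
  assumes "smooth_near g a"
  shows "\<exists>e>0. \<forall>n. \<forall>x\<in>ball a e. ((deriv ^^ n) g has_field_derivative (deriv ^^ Suc n) g x) (at x)"
proof -
  obtain S where S: "open S" "a \<in> S" "\<forall>n. \<forall>x\<in>S. (deriv ^^ n) g field_differentiable at x"
    using assms by (auto simp: smooth_near_def)
  obtain e where "e > 0" "ball a e \<subseteq> S" using S by (meson open_contains_ball)
  with S(3) show ?thesis
    by (intro exI[of _ e]) (auto simp: DERIV_deriv_iff_field_differentiable subset_iff)
qed

lemma smooth_near_deriv:
  fixes g :: "'a::real_normed_field \<Rightarrow> 'a"
  assumes "smooth_near g a"
  shows "smooth_near (deriv g) a"
proof -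
  obtain S where S: "open S" "a \<in> S" "\<forall>n. \<forall>x\<in>S. (deriv ^^ n) g field_differentiable at x"
    using assms by (auto simp: smooth_near_def)
  have "(deriv ^^ n) (deriv g) field_differentiable at x" if "x \<in> S" for n x
    using S(3)[rule_format, of x "Suc n"] that by (simp add: funpow_swap1)
  with S show ?thesis unfolding smooth_near_def by blast
qed

lemma smooth_near_continuous:
  fixes g :: "'a::real_normed_field \<Rightarrow> 'a"
  assumes "smooth_near g a"
  shows "isCont g a"
proof -
  obtain S where S: "open S" "a \<in> S" "\<forall>n. \<forall>x\<in>S. (deriv ^^ n) g field_differentiable at x"
    using assms by (auto simp: smooth_near_def)
  from S(3)[rule_format, of a 0] S(2) have "g field_differentiable at a" by simp
  then show ?thesis by (rule field_differentiable_imp_continuous_at)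
qed

lemma smooth_near_eventually_deriv:
  fixes g :: "'a::real_normed_field \<Rightarrow> 'a"
  assumes "smooth_near g a"
  shows "\<forall>\<^sub>F x in nhds a. (g has_field_derivative deriv g x) (at x)"
proof -
  obtain e where e: "e > 0"
    "\<forall>n. \<forall>x\<in>ball a e. ((deriv ^^ n) g has_field_derivative (deriv ^^ Suc n) g x) (at x)"
    using smooth_near_ball[OF assms] by blast
  show ?thesis
    using eventually_nhds_ball[OF e(1), of a]
    by (rule eventually_mono) (use e(2)[rule_format, of _ 0] in simp)
qed

section \<open>Division by \<open>x - a\<close> and Taylor expansion with smooth remainder\<close>

text \<open>Hadamard's lemma. All derivatives of the quotient at \<open>a\<close> are part of the
  claim so that the division can be iterated with known coefficients.\<close>

lemma smooth_near_divide_zero: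
  fixes g :: "'a::{real_normed_field, banach} \<Rightarrow> 'a"
  assumes "smooth_near g a"
  shows "\<exists>q. smooth_near q a \<and> (\<forall>\<^sub>F x in nhds a. g x = g a + (x - a) * q x) \<and>
             (\<forall>n. (deriv ^^ n) q a = (deriv ^^ Suc n) g a / of_nat (Suc n))"
proof -
  obtain e where e: "e > 0"
    "\<forall>n. \<forall>x\<in>ball a e. ((deriv ^^ n) g has_field_derivative (deriv ^^ Suc n) g x) (at x)"
    using smooth_near_ball[OF assms] by blast
  then have D: "((deriv ^^ n) g has_field_derivative (deriv ^^ Suc n) g x) (at x)"
    if "x \<in> ball a e" for n x using that by blast
  let ?B = "ball a e"
  define p where "p = (\<lambda>x (t::real). a + of_real t * (x - a))"
  have p_ball: "p x t \<in> ?B" if "x \<in> ?B" "t \<in> {0..1}" for x t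
  proof -
    have "dist a (p x t) = t * dist a x"
      using that(2) by (simp add: p_def dist_norm norm_mult norm_minus_commute)
    also have "\<dots> \<le> 1 * dist a x" using that(2) by (intro mult_right_mono) auto
    finally show ?thesis using that(1) by simp
  qed
  \<comment> \<open>\<open>g x - g a = (x - a) * Q 0 x\<close> by the fundamental theorem of calculus along the segment from
    \<open>a\<close> to \<open>x\<close>, and \<open>Q n' = Q (n + 1)\<close> by differentiation under the integral sign.\<close>
  define k where "k = (\<lambda>n x t. of_real t ^ n * (deriv ^^ Suc n) g (p x t))"
  define Q where "Q = (\<lambda>n x. integral (cbox 0 1) (k n x))"
  have cont_D: "continuous_on ?B ((deriv ^^ n) g)" for n
    by (rule DERIV_continuous_on, rule has_field_derivative_at_within, rule D)
  have cont_p: "continuous_on (?B \<times> cbox 0 1) (\<lambda>z. p (fst z) (snd z))"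
    unfolding p_def by (intro continuous_intros)
  have cont_k: "continuous_on (?B \<times> cbox 0 1) (\<lambda>(x, t). k n x t)" for n
    unfolding k_def split_beta
    by (intro continuous_on_mult continuous_on_power continuous_on_of_real continuous_on_snd
          continuous_on_id continuous_on_compose2[OF cont_D cont_p])
       (use p_ball in force)
  have cont_k1: "continuous_on (cbox 0 1) (k n x)" if "x \<in> ?B" for n x
    using that continuous_on_compose2[OF cont_k, of "cbox 0 1" "\<lambda>t. (x, t)" n]
    by (simp add: continuous_on_Pair image_subset_iff)
  have Q': "(Q n has_field_derivative Q (Suc n) x) (at x)" if x: "x \<in> ?B" for n x
  proof -
    have "(Q n has_field_derivative Q (Suc n) x) (at x within ?B)"
      unfolding Q_def
    proof (rule leibniz_rule_field_derivative[where f = "k n" and fx = "k (Suc n)"])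
      fix y t assume y: "y \<in> ?B" and t: "t \<in> cbox 0 (1::real)"
      have "(p y t) \<in> ?B" using y t by (intro p_ball) auto
      moreover have "((\<lambda>y. p y t) has_field_derivative of_real t) (at y)"
        unfolding p_def by (auto intro!: derivative_eq_intros)
      ultimately have "((\<lambda>y. (deriv ^^ Suc n) g (p y t)) has_field_derivative
            (deriv ^^ Suc (Suc n)) g (p y t) * of_real t) (at y)"
        by (intro DERIV_chain2[where f = "(deriv ^^ Suc n) g" and g = "\<lambda>y. p y t", OF D])
      from DERIV_cmult[OF this, of "of_real t ^ n"]
      have "((\<lambda>y. k n y t) has_field_derivative k (Suc n) y t) (at y)"
        by (simp add: k_def mult_ac)
      then show "((\<lambda>y. k n y t) has_field_derivative k (Suc n) y t) (at y within ?B)"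
        by (rule has_field_derivative_at_within)
    next
      show "k n y integrable_on cbox 0 1" if "y \<in> ?B" for y
        by (rule integrable_continuous[OF cont_k1[OF that]])
      show "continuous_on (?B \<times> cbox 0 1) (\<lambda>(x, t). k (Suc n) x t)" by (rule cont_k)
      show "x \<in> ?B" by (rule x)
      show "convex ?B" by (rule convex_ball)
    qed
    then show ?thesis unfolding at_within_open[OF x open_ball] .
  qed
  have smooth: "smooth_near (Q 0) a"
  proof (rule smooth_near_closed_family[of ?B a "range Q"])
    fix \<phi> assume "\<phi> \<in> range Q"
    then obtain n where "\<phi> = Q n" by blast
    with Q' show "\<exists>\<psi>\<in>range Q. \<forall>x\<in>?B. (\<phi> has_field_derivative \<psi> x) (at x)"
      by (intro bexI[of _ "Q (Suc n)"]) auto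
  qed (use e(1) in auto)
  have "g x = g a + (x - a) * Q 0 x" if x: "x \<in> ?B" for x
  proof -
    have "((\<lambda>t. (x - a) * k 0 x t) has_integral g (p x 1) - g (p x 0)) {0..1}"
    proof (rule fundamental_theorem_of_calculus)
      fix t :: real assume t: "t \<in> {0..1}"
      have "((\<lambda>t. p x t) has_vector_derivative (x - a)) (at t within {0..1})"
        unfolding p_def by (auto intro!: derivative_eq_intros simp: scaleR_conv_of_real)
      from field_vector_diff_chain_within[OF this
           has_field_derivative_at_within[OF D[of "p x t" 0, OF p_ball[OF x t]]]]
      show "((\<lambda>t. g (p x t)) has_vector_derivative (x - a) * k 0 x t) (at t within {0..1})"
        by (simp add: k_def o_def)
    qed simp
    moreover have "((\<lambda>t. (x - a) * k 0 x t) has_integral (x - a) * Q 0 x) {0..1}"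
      using has_integral_mult_right[OF integrable_integral[OF integrable_continuous[OF cont_k1[OF x]]]]
      by (simp add: Q_def)
    ultimately have "g (p x 1) - g (p x 0) = (x - a) * Q 0 x"
      by (rule has_integral_unique)
    then show ?thesis by (simp add: p_def algebra_simps)
  qed
  with eventually_nhds_ball[OF e(1), of a]
  have ev: "\<forall>\<^sub>F x in nhds a. g x = g a + (x - a) * Q 0 x"
    by (rule eventually_mono)
  have hd: "(deriv ^^ n) (Q 0) x = Q n x" if "x \<in> ?B" for n x
    using that
  proof (induction n arbitrary: x)
    case (Suc n)
    have "((deriv ^^ n) (Q 0) has_field_derivative Q (Suc n) x) (at x)"
      using Q'[OF Suc.prems] 
      by (rule has_field_derivative_transform_within_open[where S="?B"]) (use Suc in auto)
    then show ?case by (auto intro: DERIV_imp_deriv)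
  qed auto
  \<comment> \<open>At \<open>x = a\<close> the segment degenerates to a point, so the integrand is
    a constant times \<open>t ^ n\<close>; this yields the factor
    \<open>1 / (n + 1)\<close>.\<close>
  have "Q n a = (deriv ^^ Suc n) g a / of_nat (Suc n)" for n
  proof -
    let ?c = "(deriv ^^ Suc n) g a"
    have "((\<lambda>t::real. of_real t ^ n * ?c) has_integral
        of_real 1 ^ Suc n * ?c / of_nat (Suc n) - of_real 0 ^ Suc n * ?c / of_nat (Suc n)) {0..1}"
    proof (rule fundamental_theorem_of_calculus)
      fix t :: real assume t: "t \<in> {0..1}"
      have "((\<lambda>z. z ^ Suc n * ?c / of_nat (Suc n)) has_field_derivative of_real t ^ n * ?c) (at (of_real t))"
        by (rule derivative_eq_intros refl of_nat_neq_0)+ (simp add: field_simps del: of_nat_Suc funpow.simps)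
      then show "((\<lambda>t. of_real t ^ Suc n * ?c / of_nat (Suc n)) has_vector_derivative of_real t ^ n * ?c) (at t within {0..1})"
        using has_vector_derivative_real_field has_vector_derivative_at_within by blast
    qed simp
    then have "((\<lambda>t::real. of_real t ^ n * ?c) has_integral ?c / of_nat (Suc n)) {0..1}"
      by simp
    moreover have "k n a = (\<lambda>t. of_real t ^ n * ?c)" by (simp add: k_def p_def)
    ultimately show ?thesis unfolding Q_def box_real by (metis integral_unique)
  qed
  with hd e(1) have "\<forall>n. (deriv ^^ n) (Q 0) a = (deriv ^^ Suc n) g a / of_nat (Suc n)"
    by auto
  with smooth ev show ?thesis by blast
qed

text \<open>Repeated division by \<open>x - a\<close>. The remainder factor is smooth, not merely
  bounded, because with \<open>n = m\<close> it becomes the function whose root is taken; its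
  derivatives at the zero, suitably normalised, are then the numbers \<open>C_coeff\<close>.\<close>

lemma smooth_near_taylor:
  fixes g :: "'a::{real_normed_field, banach} \<Rightarrow> 'a"
  assumes "smooth_near g a"
  shows "\<exists>q. smooth_near q a \<and>
    (\<forall>\<^sub>F x in nhds a. g x = (\<Sum>k<n. (deriv ^^ k) g a / fact k * (x - a) ^ k) + (x - a) ^ n * q x) \<and>
    (\<forall>j. (deriv ^^ j) q a = fact j / fact (j + n) * (deriv ^^ (j + n)) g a)"
proof (induction n)
  case 0
  show ?case using assms by (intro exI[of _ g]) auto
next
  case (Suc n)
  then obtain q where q: "smooth_near q a"
    "\<forall>\<^sub>F x in nhds a. g x = (\<Sum>k<n. (deriv ^^ k) g a / fact k * (x - a) ^ k) + (x - a) ^ n * q x"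
    "\<And>j. (deriv ^^ j) q a = fact j / fact (j + n) * (deriv ^^ (j + n)) g a"
    by blast
  obtain q' where q': "smooth_near q' a" "\<forall>\<^sub>F x in nhds a. q x = q a + (x - a) * q' x"
    "\<And>n. (deriv ^^ n) q' a = (deriv ^^ Suc n) q a / of_nat (Suc n)"
    using smooth_near_divide_zero[OF q(1)] by blast
  have qa: "q a = (deriv ^^ n) g a / fact n" using q(3)[of 0] by simp
  show ?case
  proof (intro exI[of _ q'] conjI allI q')
    show "\<forall>\<^sub>F x in nhds a. g x = (\<Sum>k<Suc n. (deriv ^^ k) g a / fact k * (x - a) ^ k) + (x - a) ^ Suc n * q' x"
      using q(2) q'(2)
    proof eventually_elim
      case (elim x)
      show ?case by (subst elim(1), subst elim(2)) (simp add: qa algebra_simps)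
    qed
  next
    fix j
    show "(deriv ^^ j) q' a = fact j / fact (j + Suc n) * (deriv ^^ (j + Suc n)) g a"
      unfolding q'(3) q(3) fact_Suc add_Suc_right add_Suc by (simp del: of_nat_Suc funpow.simps fact_Suc)
  qed
qed

section \<open>Smooth roots through rings closed under differentiation\<close>

inductive_set ring_closure :: "('a::real_normed_field \<Rightarrow> 'a) set \<Rightarrow> ('a \<Rightarrow> 'a) set"
  for G where
  gen: "g \<in> G \<Longrightarrow> g \<in> ring_closure G"
| const: "(\<lambda>_. c) \<in> ring_closure G"
| add: "f \<in> ring_closure G \<Longrightarrow> g \<in> ring_closure G \<Longrightarrow> (\<lambda>x. f x + g x) \<in> ring_closure G"
| mult: "f \<in> ring_closure G \<Longrightarrow> g \<in> ring_closure G \<Longrightarrow> (\<lambda>x. f x * g x) \<in> ring_closure G"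

text \<open>By the sum and product rules, differentiation maps the whole ring into itself as soon as
  it maps the generators into it.\<close>

lemma smooth_near_ring_closure:
  fixes G :: "('a::real_normed_field \<Rightarrow> 'a) set"
  assumes S: "open S" "a \<in> S"
    and G: "\<And>g. g \<in> G \<Longrightarrow> \<exists>\<psi>\<in>ring_closure G. \<forall>x\<in>S. (g has_field_derivative \<psi> x) (at x)"
    and \<phi>: "\<phi> \<in> ring_closure G"
  shows "smooth_near \<phi> a"
proof (rule smooth_near_closed_family[OF S _ \<phi>])
  fix \<phi> assume "\<phi> \<in> ring_closure G"
  then show "\<exists>\<psi>\<in>ring_closure G. \<forall>x\<in>S. (\<phi> has_field_derivative \<psi> x) (at x)"
  proof induction
    case (gen g)
    then show ?case by (rule G)
  next
    case (const c)
    show ?case by (rule bexI[OF _ ring_closure.const[of 0]]) auto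
  next
    case (add f g)
    then obtain f' g' where "f' \<in> ring_closure G" "g' \<in> ring_closure G"
      "\<forall>x\<in>S. (f has_field_derivative f' x) (at x)" "\<forall>x\<in>S. (g has_field_derivative g' x) (at x)"
      by blast
    then show ?case
      by (intro bexI[OF _ ring_closure.add[of f' G g']]) (auto intro: DERIV_add)
  next
    case (mult f g)
    then obtain f' g' where fg: "f' \<in> ring_closure G" "g' \<in> ring_closure G"
      "\<forall>x\<in>S. (f has_field_derivative f' x) (at x)" "\<forall>x\<in>S. (g has_field_derivative g' x) (at x)"
      by blast
    show ?case
      by (rule bexI[OF _ ring_closure.add[OF ring_closure.mult[OF fg(1) mult.hyps(2)]
              ring_closure.mult[OF fg(2) mult.hyps(1)]]])
         (use fg in \<open>auto intro: DERIV_mult\<close>)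
  qed
qed

text \<open>
  The local root \<open>\<rho>\<close> at 1 is a parameter because a common proof for real and complex numbers
  has no logarithm at hand. Smoothness of \<open>r = \<rho>(q / q(a))\<close> follows since \<open>r' = r q' / (m q)\<close>, so
  that the ring generated by \<open>r\<close>, \<open>1/q\<close> and the derivatives of \<open>q\<close> is closed under derivation.
\<close>
lemma smooth_near_root:
  fixes q \<rho> :: "'a::real_normed_field \<Rightarrow> 'a"
  assumes q: "smooth_near q a" "q a \<noteq> 0"
    and \<rho>: "\<forall>\<^sub>F z in nhds 1. \<rho> z ^ m = z \<and> (\<rho> has_field_derivative \<rho> z / (of_nat m * z)) (at z)"
      "\<rho> 1 = 1"
  shows "\<exists>r. smooth_near r a \<and> r a = 1 \<and> (\<forall>\<^sub>F x in nhds a. r x ^ m = q x / q a)"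
proof -
  obtain e where e: "e > 0"
    "\<forall>n. \<forall>x\<in>ball a e. ((deriv ^^ n) q has_field_derivative (deriv ^^ Suc n) q x) (at x)"
    using smooth_near_ball[OF q(1)] by blast
  have q_lim: "((\<lambda>x. q x / q a) \<longlongrightarrow> 1) (nhds a)" "(q \<longlongrightarrow> q a) (nhds a)"
    using smooth_near_continuous[OF q(1)] q(2)
    by (auto intro!: tendsto_eq_intros simp: isCont_def tendsto_at_iff_tendsto_nhds)
  define r where "r = (\<lambda>x. \<rho> (q x / q a))"
  \<comment> \<open>\<open>D\<close> collects everything required at a point near \<open>a\<close>,
    so that one open set \<open>S\<close> serves all generators: the root identity,
    \<open>q x \<noteq> 0\<close> for the reciprocal, the ball for the derivatives of
    \<open>q\<close>, and differentiability of \<open>\<rho>\<close> at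
    \<open>q x / q a\<close>.\<close>
  define D where "D = (\<lambda>x. r x ^ m = q x / q a \<and> q x \<noteq> 0 \<and> x \<in> ball a e \<and>
     (\<rho> has_field_derivative \<rho> (q x / q a) / (of_nat m * (q x / q a))) (at (q x / q a)))"
  have "\<forall>\<^sub>F x in nhds a. D x"
    using eventually_compose_filterlim[OF \<rho>(1) q_lim(1)] tendsto_imp_eventually_ne[OF q_lim(2) q(2)]
      eventually_nhds_ball[OF e(1), of a]
    by eventually_elim (auto simp: D_def r_def)
  then obtain S where S: "open S" "a \<in> S" "\<forall>x\<in>S. D x"
    by (auto simp: eventually_nhds)
  let ?G = "insert r (insert (\<lambda>x. inverse (q x)) (range (\<lambda>n. (deriv ^^ n) q)))"
  have q'_in: "(deriv ^^ n) q \<in> ring_closure ?G" for n by (intro ring_closure.gen) auto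
  have r_in: "r \<in> ring_closure ?G" and i_in: "(\<lambda>x. inverse (q x)) \<in> ring_closure ?G"
    by (intro ring_closure.gen; simp)+
  have dq: "((deriv ^^ n) q has_field_derivative (deriv ^^ Suc n) q x) (at x)" if "x \<in> S" for n x
    using that S(3) e(2) by (auto simp: D_def)
  have "smooth_near r a"
  proof (rule smooth_near_ring_closure[where G = ?G, OF S(1,2) _ r_in])
    fix g assume "g \<in> ?G"
    then consider "g = r" | "g = (\<lambda>x. inverse (q x))" | n where "g = (deriv ^^ n) q" by blast
    then show "\<exists>\<psi>\<in>ring_closure ?G. \<forall>x\<in>S. (g has_field_derivative \<psi> x) (at x)"
    proof cases
      case 1
      show ?thesis
      proof (rule bexI[OF _ ring_closure.mult[OF ring_closure.const[of "1 / of_nat m"]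
              ring_closure.mult[OF r_in ring_closure.mult[OF q'_in[of 1] i_in]]]])
        show "\<forall>x\<in>S. (g has_field_derivative (1 / of_nat m) * (r x * ((deriv ^^ 1) q x * inverse (q x)))) (at x)"
        proof
          fix x assume x: "x \<in> S"
          have "((\<lambda>x. q x / q a) has_field_derivative deriv q x / q a) (at x)"
            using DERIV_cdivide[OF dq[OF x, of 0]] by simp
          with x S(3) have "(r has_field_derivative
              \<rho> (q x / q a) / (of_nat m * (q x / q a)) * (deriv q x / q a)) (at x)"
            unfolding r_def D_def
            using DERIV_chain2[where f = \<rho> and g = "\<lambda>x. q x / q a"] by blast
          then show "(g has_field_derivative (1 / of_nat m) * (r x * ((deriv ^^ 1) q x * inverse (q x)))) (at x)"
            using 1 q(2) by (simp add: r_def field_simps)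
        qed
      qed
    next
      case 2
      show ?thesis
      proof (rule bexI[OF _ ring_closure.mult[OF ring_closure.const[of "-1"]
              ring_closure.mult[OF q'_in[of 1] ring_closure.mult[OF i_in i_in]]]])
        show "\<forall>x\<in>S. (g has_field_derivative (-1) * ((deriv ^^ 1) q x * (inverse (q x) * inverse (q x)))) (at x)"
        proof
          fix x assume x: "x \<in> S"
          then have "q x \<noteq> 0" using S(3) by (simp add: D_def)
          from DERIV_inverse'[OF dq[OF x, of 0, unfolded funpow_0] this]
          show "(g has_field_derivative (-1) * ((deriv ^^ 1) q x * (inverse (q x) * inverse (q x)))) (at x)"
            unfolding 2 by (simp add: mult_ac)
        qed
      qed
    next
      case 3
      show ?thesis unfolding 3 by (rule bexI[OF _ q'_in[of "Suc n"]]) (intro ballI dq)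
    qed
  qed
  moreover have "r a = 1" using q(2) \<rho>(2) by (simp add: r_def)
  moreover have "\<forall>\<^sub>F x in nhds a. r x ^ m = q x / q a"
    using \<open>\<forall>\<^sub>F x in nhds a. D x\<close> by (auto elim!: eventually_mono simp: D_def)
  ultimately show ?thesis by blast
qed

section \<open>Second-order expansions with bounded remainder\<close>

text \<open>The cubic remainder carries a factor \<open>w\<close> that is only bounded, so each
  operation on expansions reduces to algebra and boundedness. The filter is \<open>nhds a\<close>
  and not \<open>at a\<close> because in a composition the inner function may take its central value
  at points other than \<open>a\<close>.\<close>

definition jet2 :: "'a::real_normed_field \<Rightarrow> ('a \<Rightarrow> 'a) \<Rightarrow> 'a \<Rightarrow> 'a \<Rightarrow> 'a \<Rightarrow> bool" where
  "jet2 a f c0 c1 c2 \<longleftrightarrow> (\<exists>w\<in>O[nhds a](\<lambda>_. 1).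
     \<forall>\<^sub>F x in nhds a. f x = c0 + c1 * (x - a) + c2 * (x - a) ^ 2 + (x - a) ^ 3 * w x)"

lemma jet2_cong:
  assumes "jet2 a f c0 c1 c2" "\<forall>\<^sub>F x in nhds a. f x = g x"
  shows "jet2 a g c0 c1 c2"
proof -
  obtain w where "w \<in> O[nhds a](\<lambda>_. 1)"
    "\<forall>\<^sub>F x in nhds a. f x = c0 + c1 * (x - a) + c2 * (x - a) ^ 2 + (x - a) ^ 3 * w x"
    using assms(1) by (auto simp: jet2_def)
  with assms(2) show ?thesis unfolding jet2_def
    by (intro bexI[of _ w]) (auto elim: eventually_elim2)
qed

lemma jet2_eqI:
  "jet2 a f c0 c1 c2 \<Longrightarrow> c0 = d0 \<Longrightarrow> c1 = d1 \<Longrightarrow> c2 = d2 \<Longrightarrow> jet2 a f d0 d1 d2"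
  by simp

lemma diff_bigo_1: "(\<lambda>x. x - a) \<in> O[nhds (a::'a::real_normed_field)](\<lambda>_. 1)"
  by (rule bigoI_tendsto[where c = 0]) (auto intro!: tendsto_eq_intros filterlim_ident)

lemma jet2_tendsto:
  assumes "jet2 a f c0 c1 c2"
  shows "(f \<longlongrightarrow> c0) (nhds a)"
proof -
  obtain w where w: "w \<in> O[nhds a](\<lambda>_. 1)"
    "\<forall>\<^sub>F x in nhds a. f x = c0 + c1 * (x - a) + c2 * (x - a) ^ 2 + (x - a) ^ 3 * w x"
    using assms(1) by (auto simp: jet2_def)
  have "(\<lambda>x. x - a) \<in> o[nhds a](\<lambda>_. 1)"
    by (rule smalloI_tendsto) (auto intro!: tendsto_eq_intros filterlim_ident)
  then have "(\<lambda>x. (x - a) * (c1 + c2 * (x - a) + (x - a) ^ 2 * w x)) \<in> o[nhds a](\<lambda>_. 1 * 1)"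
    unfolding power2_eq_square
    by (intro landau_o.small_big_mult sum_in_bigo landau_o.big.mult_in_1 w diff_bigo_1 bigo_const)
  then have "((\<lambda>x. (x - a) * (c1 + c2 * (x - a) + (x - a) ^ 2 * w x)) \<longlongrightarrow> 0) (nhds a)"
    by (auto dest: smalloD_tendsto)
  then have "((\<lambda>x. c0 + (x - a) * (c1 + c2 * (x - a) + (x - a) ^ 2 * w x)) \<longlongrightarrow> c0) (nhds a)"
    by (auto intro: tendsto_eq_intros)
  then show ?thesis
    by (rule Lim_transform_eventually)
       (use w(2) in \<open>eventually_elim; simp add: algebra_simps power2_eq_square power3_eq_cube\<close>)
qed

lemma tendsto_imp_bigo_1: "(f \<longlongrightarrow> c) F \<Longrightarrow> f \<in> O[F](\<lambda>_. 1)"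
  for c :: "'a::real_normed_field"
  by (rule bigoI_tendsto[where c = c]) auto

lemma jet2_const: "jet2 a (\<lambda>_. c) c 0 0"
  unfolding jet2_def by (rule bexI[of _ "\<lambda>_. 0"]) auto

lemma jet2_diff_id: "jet2 a (\<lambda>x. x - a) 0 1 0"
  unfolding jet2_def by (rule bexI[of _ "\<lambda>_. 0"]) auto

lemma jet2_add:
  assumes "jet2 a f c0 c1 c2" "jet2 a g d0 d1 d2"
  shows "jet2 a (\<lambda>x. f x + g x) (c0 + d0) (c1 + d1) (c2 + d2)"
proof -
  obtain v w where v: "v \<in> O[nhds a](\<lambda>_. 1)"
    "\<forall>\<^sub>F x in nhds a. f x = c0 + c1 * (x - a) + c2 * (x - a) ^ 2 + (x - a) ^ 3 * v x"
    and w: "w \<in> O[nhds a](\<lambda>_. 1)"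
    "\<forall>\<^sub>F x in nhds a. g x = d0 + d1 * (x - a) + d2 * (x - a) ^ 2 + (x - a) ^ 3 * w x"
    using assms by (auto simp: jet2_def)
  show ?thesis unfolding jet2_def
  proof (rule bexI)
    show "\<forall>\<^sub>F x in nhds a. f x + g x = (c0 + d0) + (c1 + d1) * (x - a) + (c2 + d2) * (x - a) ^ 2
        + (x - a) ^ 3 * (v x + w x)"
      using v(2) w(2) by eventually_elim (simp add: algebra_simps)
  qed (intro sum_in_bigo v w)
qed

lemma jet2_mult:
  assumes "jet2 a f c0 c1 c2" "jet2 a g d0 d1 d2"
  shows "jet2 a (\<lambda>x. f x * g x) (c0 * d0) (c0 * d1 + c1 * d0) (c0 * d2 + c1 * d1 + c2 * d0)"
proof -
  obtain v w where v: "v \<in> O[nhds a](\<lambda>_. 1)"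
    "\<forall>\<^sub>F x in nhds a. f x = c0 + c1 * (x - a) + c2 * (x - a) ^ 2 + (x - a) ^ 3 * v x"
    and w: "w \<in> O[nhds a](\<lambda>_. 1)"
    "\<forall>\<^sub>F x in nhds a. g x = d0 + d1 * (x - a) + d2 * (x - a) ^ 2 + (x - a) ^ 3 * w x"
    using assms by (auto simp: jet2_def)
  have g: "g \<in> O[nhds a](\<lambda>_. 1)"
    using jet2_tendsto[OF assms(2)] by (rule tendsto_imp_bigo_1)
  show ?thesis unfolding jet2_def
  proof (rule bexI)
    show "\<forall>\<^sub>F x in nhds a. f x * g x =
        c0 * d0 + (c0 * d1 + c1 * d0) * (x - a) + (c0 * d2 + c1 * d1 + c2 * d0) * (x - a) ^ 2
        + (x - a) ^ 3 * (v x * g x + c0 * w x + c1 * (d2 + (x - a) * w x)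
            + c2 * (d1 + (x - a) * (d2 + (x - a) * w x)))"
      using v(2) w(2)
    proof eventually_elim
      case (elim x)
      define e where "e = x - a"
      define V W where "V = v x" and "W = w x"
      have "f x * g x = (c0 + c1 * e + c2 * e ^ 2) * g x + e ^ 3 * (V * g x)"
        by (simp add: elim(1) e_def V_def algebra_simps)
      \<comment> \<open>Each term expands \<open>g\<close> only as far as needed to split off
        \<open>e ^ 3\<close>; the factor \<open>V * g x\<close> stays unexpanded, since
        \<open>g\<close> is bounded.\<close>
      also have "(c0 + c1 * e + c2 * e ^ 2) * g x = 
         c0 * d0 + (c0 * d1 + c1 * d0) * e + (c0 * d2 + c1 * d1 + c2 * d0) * e ^ 2
        + e ^ 3 * (c0 * W + c1 * (d2 + e * W) + c2 * (d1 + e * (d2 + e * W)))"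
        unfolding elim(2) e_def[symmetric] W_def[symmetric]
        by (simp add: algebra_simps power2_eq_square power3_eq_cube)
      finally show ?case by (simp add: e_def V_def W_def algebra_simps)
    qed
  qed (intro sum_in_bigo landau_o.big.mult_in_1 v w g diff_bigo_1 bigo_const)
qed

lemma jet2_inverse:
  assumes "jet2 a f 1 c1 c2"
  shows "jet2 a (\<lambda>x. inverse (f x)) 1 (- c1) (c1 ^ 2 - c2)"
proof -
  obtain w where w: "w \<in> O[nhds a](\<lambda>_. 1)"
    "\<forall>\<^sub>F x in nhds a. f x = 1 + c1 * (x - a) + c2 * (x - a) ^ 2 + (x - a) ^ 3 * w x"
    using assms by (auto simp: jet2_def)
  have f: "(f \<longlongrightarrow> 1) (nhds a)" by (rule jet2_tendsto[OF assms])
  have i: "(\<lambda>x. inverse (f x)) \<in> O[nhds a](\<lambda>_. 1)"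
    by (rule tendsto_imp_bigo_1, rule tendsto_inverse[OF f]) simp
  have nz: "\<forall>\<^sub>F x in nhds a. f x \<noteq> 0" by (rule tendsto_imp_eventually_ne[OF f]) simp
  show ?thesis unfolding jet2_def
  proof (rule bexI)
    show "\<forall>\<^sub>F x in nhds a. inverse (f x) = 1 + (- c1) * (x - a) + (c1 ^ 2 - c2) * (x - a) ^ 2
        + (x - a) ^ 3 * (inverse (f x) * (c1 * c2 + - (c1 * (c1 ^ 2 - c2)) + - 1 * w x
           + (x - a) * (c1 * w x + - (c2 * (c1 ^ 2 - c2)) + (x - a) * ((c2 - c1 ^ 2) * w x))))"
      using w(2) nz
    proof eventually_elim
      case (elim x)
      define e where "e = x - a"
      define W where "W = w x"
      \<comment> \<open>\<open>s\<close> is the reciprocal series cut off after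
        \<open>e ^ 2\<close>, and \<open>t\<close> is chosen so that
        \<open>f x * s = 1 - e ^ 3 * t\<close> holds exactly. Multiplying by
        \<open>inverse (f x)\<close> then gives the expansion.\<close>
      define s where "s = 1 + (- c1) * e + (c1 ^ 2 - c2) * e ^ 2"
      define t where "t = c1 * c2 + - (c1 * (c1 ^ 2 - c2)) + - 1 * W
           + e * (c1 * W + - (c2 * (c1 ^ 2 - c2)) + e * ((c2 - c1 ^ 2) * W))"
      have "f x * s + e ^ 3 * t = 1"
        unfolding elim(1) e_def[symmetric] W_def[symmetric] s_def t_def
        by (simp add: algebra_simps power2_eq_square power3_eq_cube)
      then have "inverse (f x) = s + e ^ 3 * (inverse (f x) * t)"
        using elim(2) by (simp add: field_simps)
      then show ?case by (simp add: s_def t_def e_def W_def)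
    qed
  qed (intro sum_in_bigo landau_o.big.mult_in_1 w i diff_bigo_1 bigo_const)
qed

lemma jet2_smooth:
  fixes g :: "'a::{real_normed_field, banach} \<Rightarrow> 'a"
  assumes "smooth_near g a"
  shows "jet2 a g (g a) (deriv g a) ((deriv ^^ 2) g a / 2)"
proof -
  obtain q where "smooth_near q a"
    "\<forall>\<^sub>F x in nhds a. g x = (\<Sum>k<3. (deriv ^^ k) g a / fact k * (x - a) ^ k) + (x - a) ^ 3 * q x"
    using smooth_near_taylor[OF assms, of 3] by blast
  moreover from this have "q \<in> O[nhds a](\<lambda>_. 1)"
    using smooth_near_continuous[of q a] 
    by (intro tendsto_imp_bigo_1[of _ "q a"]) (auto simp: isCont_def tendsto_at_iff_tendsto_nhds)
  ultimately show ?thesis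
    unfolding jet2_def by (intro bexI[of _ q]) (auto simp: numeral_3_eq_3 numeral_2_eq_2)
qed

lemma jet2_compose:
  fixes g :: "'a::{real_normed_field, banach} \<Rightarrow> 'a"
  assumes g: "smooth_near g b" and f: "jet2 a f b c1 c2"
  shows "jet2 a (\<lambda>x. g (f x)) (g b) (deriv g b * c1) (deriv g b * c2 + (deriv ^^ 2) g b / 2 * c1 ^ 2)"
proof -
  define p where "p = (deriv ^^ 2) g b / 2"
  obtain w where w: "w \<in> O[nhds b](\<lambda>_. 1)"
    "\<forall>\<^sub>F x in nhds b. g x = g b + deriv g b * (x - b) + p * (x - b) ^ 2 + (x - b) ^ 3 * w x"
    using jet2_smooth[OF g] by (auto simp: jet2_def p_def)
  obtain v where v: "v \<in> O[nhds a](\<lambda>_. 1)"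
    "\<forall>\<^sub>F x in nhds a. f x = b + c1 * (x - a) + c2 * (x - a) ^ 2 + (x - a) ^ 3 * v x"
    using f by (auto simp: jet2_def)
  have lim: "filterlim f (nhds b) (nhds a)" by (rule jet2_tendsto[OF f])
  have w': "(\<lambda>x. w (f x)) \<in> O[nhds a](\<lambda>_. 1)"
    using landau_o.big.compose[OF w(1) lim] .
  \<comment> \<open>\<open>d\<close> is the quotient of \<open>f x - b\<close> by
    \<open>x - a\<close>. In the remainder below, \<open>d ^ 2 - c1 ^ 2\<close> is factored as
    \<open>(d - c1) * (d + c1)\<close>, whose first factor is again divisible by
    \<open>x - a\<close>.\<close>
  define d where "d = (\<lambda>x. c1 + (x - a) * (c2 + (x - a) * v x))"
  have d: "d \<in> O[nhds a](\<lambda>_. 1)"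
    unfolding d_def by (intro sum_in_bigo landau_o.big.mult_in_1 v diff_bigo_1 bigo_const)
  show ?thesis unfolding jet2_def p_def[symmetric]
  proof (rule bexI)
    show "\<forall>\<^sub>F x in nhds a. g (f x) = g b + deriv g b * c1 * (x - a)
         + (deriv g b * c2 + p * c1 ^ 2) * (x - a) ^ 2
         + (x - a) ^ 3 * (deriv g b * v x + p * ((c2 + (x - a) * v x) * (c1 + d x))
             + d x * d x * d x * w (f x))"
      using v(2) eventually_compose_filterlim[OF w(2) lim]
    proof eventually_elim
      case (elim x)
      define e where "e = x - a"
      define W where "W = w (f x)"
      have fb: "f x - b = e * d x" using elim(1)
        by (simp add: d_def e_def algebra_simps power2_eq_square power3_eq_cube)
      have dx: "d x = c1 + e * (c2 + e * v x)" by (simp add: d_def e_def)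
      have "g (f x) = g b + deriv g b * (e * d x) + p * (e * d x) ^ 2 + (e * d x) ^ 3 * W"
        using elim(2) unfolding fb W_def .
      also have "\<dots> = g b + deriv g b * c1 * e + (deriv g b * c2 + p * c1 ^ 2) * e ^ 2
         + e ^ 3 * (deriv g b * v x + p * ((c2 + e * v x) * (c1 + d x)) + d x * d x * d x * W)"
        by (simp add: dx algebra_simps power2_eq_square power3_eq_cube)
      finally show ?case by (simp add: e_def W_def)
    qed
  qed (intro sum_in_bigo landau_o.big.mult_in_1 w' d v diff_bigo_1 bigo_const)
qed

lemma jet2_power:
  assumes "jet2 a f 1 c1 c2"
  shows "jet2 a (\<lambda>x. f x ^ m) 1 (of_nat m * c1)
           (of_nat m * c2 + of_nat m * (of_nat m - 1) / 2 * c1 ^ 2)"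
proof (induction m)
  case 0
  show ?case using jet2_const[of a 1] by simp
next
  case (Suc m)
  show ?case unfolding power_Suc
    by (rule jet2_eqI[OF jet2_mult[OF assms Suc]]) (simp_all add: field_simps power2_eq_square)
qed

text \<open>Letting \<open>x\<close> tend to \<open>a\<close> leaves only \<open>k\<close>. The
  punctured filter is essential for the use on successive coefficients, where powers of
  \<open>x - a\<close> are cancelled first.\<close>

lemma jet2_zero_step:
  fixes k :: "'a::real_normed_field"
  assumes w: "w \<in> O[at a](\<lambda>_. 1)" and ev: "\<forall>\<^sub>F x in at a. k + (x - a) * w x = 0"
  shows "k = 0"
proof -
  have "(\<lambda>x. x - a) \<in> o[at a](\<lambda>_. 1)"
    by (rule smalloI_tendsto) (auto intro!: tendsto_eq_intros)
  from landau_o.small_big_mult[OF this w] have "((\<lambda>x. (x - a) * w x) \<longlongrightarrow> 0) (at a)"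
    by (auto dest: smalloD_tendsto)
  then have "((\<lambda>x. k + (x - a) * w x) \<longlongrightarrow> k + 0) (at a)" by (intro tendsto_intros)
  moreover have "((\<lambda>x. k + (x - a) * w x) \<longlongrightarrow> 0) (at a)"
    using tendsto_eventually[OF ev] .
  ultimately show ?thesis using tendsto_unique[OF trivial_limit_at] by fastforce
qed

text \<open>Allows the expansion of \<open>r ^ m\<close> computed from that of \<open>r\<close> to
  be compared with the one read off from the derivatives of \<open>f\<close>.\<close>

lemma jet2_unique:
  assumes "jet2 a f c0 c1 c2" "jet2 a f d0 d1 d2"
  shows "c0 = d0" "c1 = d1" "c2 = d2"
proof -
  have "jet2 a (\<lambda>x. f x + (-1) * f x) (c0 - d0) (c1 - d1) (c2 - d2)"
    using jet2_add[OF assms(1) jet2_mult[OF jet2_const[of a "-1"] assms(2)]] by simp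
  then obtain w where "w \<in> O[nhds a](\<lambda>_. 1)"
    "\<forall>\<^sub>F x in nhds a. f x + (-1) * f x = (c0 - d0) + (c1 - d1) * (x - a) + (c2 - d2) * (x - a) ^ 2 + (x - a) ^ 3 * w x"
    by (auto simp: jet2_def)
  moreover have "at a \<le> nhds a" by (simp add: at_within_def)
  ultimately have w: "w \<in> O[at a](\<lambda>_. 1)"
    and ev: "\<forall>\<^sub>F x in at a. 0 = (c0 - d0) + (c1 - d1) * (x - a) + (c2 - d2) * (x - a) ^ 2 + (x - a) ^ 3 * w x"
    by (auto intro: landau_o.big.filter_mono filter_leD)
  have e: "(\<lambda>x. x - a) \<in> O[at a](\<lambda>_. 1)"
    using \<open>at a \<le> nhds a\<close> diff_bigo_1 landau_o.big.filter_mono by blast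
  note intros = sum_in_bigo landau_o.big.mult_in_1 e w bigo_const
  have ne: "\<forall>\<^sub>F x in at a. x \<noteq> a" by (simp add: eventually_at_filter)
  have 0: "c0 - d0 = 0"
  proof (rule jet2_zero_step[of "\<lambda>x. (c1 - d1) + (x - a) * ((c2 - d2) + (x - a) * w x)"])
    show "\<forall>\<^sub>F x in at a. c0 - d0 + (x - a) * (c1 - d1 + (x - a) * (c2 - d2 + (x - a) * w x)) = 0"
      using ev by eventually_elim (simp add: algebra_simps power2_eq_square power3_eq_cube)
  qed (intro intros)
  have 1: "c1 - d1 = 0"
  proof (rule jet2_zero_step[of "\<lambda>x. (c2 - d2) + (x - a) * w x"])
    show "\<forall>\<^sub>F x in at a. c1 - d1 + (x - a) * (c2 - d2 + (x - a) * w x) = 0"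
      using ev ne
    proof eventually_elim
      case (elim x)
      have "(x - a) * (c1 - d1 + (x - a) * (c2 - d2 + (x - a) * w x)) = 0"
        using elim(1) unfolding 0 by (simp add: algebra_simps power2_eq_square power3_eq_cube)
      with elim(2) show ?case by simp
    qed
  qed (intro intros)
  have 2: "c2 - d2 = 0"
  proof (rule jet2_zero_step[of w])
    show "\<forall>\<^sub>F x in at a. c2 - d2 + (x - a) * w x = 0"
      using ev ne
    proof eventually_elim
      case (elim x)
      have "(x - a) ^ 2 * (c2 - d2 + (x - a) * w x) = 0"
        using elim(1) unfolding 0 1 by (simp add: algebra_simps power2_eq_square power3_eq_cube)
      with elim(2) show ?case by simp
    qed
  qed (intro intros)
  show "c0 = d0" "c1 = d1" "c2 = d2" using 0 1 2 by auto
qed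

section \<open>Error expansion of one iteration step\<close>

lemma two_point_iteration_expansion:
  fixes f P \<rho> :: "'a::{real_normed_field, banach} \<Rightarrow> 'a"
  assumes m: "m \<ge> 1"
    and f: "smooth_near f \<alpha>" "zero_of_multiplicity f \<alpha> m"
    and P: "smooth_near P 0" "P 0 = 1" "deriv P 0 = 2"
    and \<rho>: "\<forall>\<^sub>F z in nhds 1. \<rho> z ^ m = z \<and> (\<rho> has_field_derivative \<rho> z / (of_nat m * z)) (at z)"
      "\<rho> 1 = 1"
  defines "K \<equiv> (- 2 * of_nat m * C_coeff f \<alpha> m 1 * C_coeff f \<alpha> m 2
                     + C_coeff f \<alpha> m 1 ^ 3 * (9 + of_nat m - (deriv ^^ 2) P 0))
                   / (2 * of_nat m ^ 3)"
  shows "iteration_order f \<alpha> m P 4 \<and>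
         (\<exists>R \<in> O[at \<alpha>](\<lambda>t. (t - \<alpha>) ^ 5).
            \<forall>x y u. two_point_iteration f \<alpha> m P x y u \<longrightarrow>
              (\<forall>k. f (x k) \<noteq> 0 \<longrightarrow>
                 x (Suc k) - \<alpha> = K * (x k - \<alpha>) ^ 4 + R (x k)))"
proof -
  define M where "M = (of_nat m :: 'a)"
  have M: "M \<noteq> 0" using m by (simp add: M_def)
  obtain q where q: "smooth_near q \<alpha>"
    "\<forall>\<^sub>F x in nhds \<alpha>. f x = (\<Sum>k<m. (deriv ^^ k) f \<alpha> / fact k * (x - \<alpha>) ^ k) + (x - \<alpha>) ^ m * q x"
    "\<And>j. (deriv ^^ j) q \<alpha> = fact j / fact (j + m) * (deriv ^^ (j + m)) f \<alpha>"
    using smooth_near_taylor[OF f(1), of m] by blast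
  define c where "c = q \<alpha>"
  have c: "c = (deriv ^^ m) f \<alpha> / fact m" using q(3)[of 0] by (simp add: c_def)
  have c0: "c \<noteq> 0" using f(2) by (simp add: c zero_of_multiplicity_def)
  have f_eq: "\<forall>\<^sub>F x in nhds \<alpha>. f x = (x - \<alpha>) ^ m * q x"
    using q(2) by eventually_elim (use f(2) in \<open>simp add: zero_of_multiplicity_def\<close>)
  have cof: "\<forall>\<^sub>F x in nhds \<alpha>. cofactor f \<alpha> m x = q x / c"
    using f_eq
  proof eventually_elim
    case (elim x)
    show ?case
    proof (cases "x = \<alpha>")
      case True
      then show ?thesis using c0 by (simp add: cofactor_def c_def)
    next
      case False
      then show ?thesis
        unfolding cofactor_def c[symmetric] by (simp add: elim)
    qed
  qed
  define r where "r = smooth_root m (cofactor f \<alpha> m) \<alpha>"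
  obtain r0 where r0: "smooth_near r0 \<alpha>" "r0 \<alpha> = 1" "\<forall>\<^sub>F x in nhds \<alpha>. r0 x ^ m = q x / c"
    using smooth_near_root[OF q(1) _ \<rho>] c0 unfolding c_def by blast
  have "\<forall>\<^sub>F x in nhds \<alpha>. r0 x ^ m = cofactor f \<alpha> m x"
    using r0(3) cof by eventually_elim simp
  with r0(1,2) have "\<exists>r. smooth_near r \<alpha> \<and> r \<alpha> = 1 \<and> (\<forall>\<^sub>F x in nhds \<alpha>. r x ^ m = cofactor f \<alpha> m x)"
    by (intro exI[of _ r0] conjI)
  \<comment> \<open>The chosen root need not be \<open>r0\<close> away from \<open>\<alpha>\<close>.
    Existence suffices: from here on only the three defining properties of \<open>r\<close> are
    used.\<close>
  from someI_ex[OF this, folded smooth_root_def r_def]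
  have "smooth_near r \<alpha> \<and> r \<alpha> = 1 \<and> (\<forall>\<^sub>F x in nhds \<alpha>. r x ^ m = cofactor f \<alpha> m x)" .
  then have r: "smooth_near r \<alpha>" "r \<alpha> = 1" and r_cof: "\<forall>\<^sub>F x in nhds \<alpha>. r x ^ m = cofactor f \<alpha> m x"
    by auto
  have r_pow: "\<forall>\<^sub>F x in nhds \<alpha>. r x ^ m = q x / c"
    using r_cof cof by eventually_elim simp
  define a b where "a = deriv r \<alpha>" and "b = (deriv ^^ 2) r \<alpha> / 2"
  have jr: "jet2 \<alpha> r 1 a b" using jet2_smooth[OF r(1)] by (simp add: r(2) a_def b_def)
  have jq: "jet2 \<alpha> (\<lambda>x. q x * inverse c) (c * inverse c) (deriv q \<alpha> * inverse c) ((deriv ^^ 2) q \<alpha> / 2 * inverse c)"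
    using jet2_mult[OF jet2_smooth[OF q(1)] jet2_const[of \<alpha> "inverse c"]] by (simp add: c_def)
  have "jet2 \<alpha> (\<lambda>x. r x ^ m) 1 (C_coeff f \<alpha> m 1) (C_coeff f \<alpha> m 2)"
  proof (rule jet2_cong[OF jet2_eqI[OF jq]])
    show "\<forall>\<^sub>F x in nhds \<alpha>. q x * inverse c = r x ^ m"
      using r_pow by eventually_elim (simp add: divide_inverse)
    show "c * inverse c = 1" using c0 by simp
    show "deriv q \<alpha> * inverse c = C_coeff f \<alpha> m 1"
      using q(3)[of 1] by (simp add: c C_coeff_def)
    show "(deriv ^^ 2) q \<alpha> / 2 * inverse c = C_coeff f \<alpha> m 2"
      using q(3)[of 2] by (simp add: c C_coeff_def add.commute del: funpow.simps fact_Suc)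
  qed
  note uniq = jet2_unique[OF this jet2_power[OF jr]]
  have Ca: "C_coeff f \<alpha> m 1 = M * a"
    using uniq(2) by (simp add: M_def)
  have Cb: "C_coeff f \<alpha> m 2 = M * b + M * (M - 1) / 2 * a ^ 2"
    using uniq(3) by (simp add: M_def)

  \<comment> \<open>With \<open>e = x - \<alpha>\<close>: \<open>F'\<close> is the derivative of \<open>e r(x)\<close>, the Newton point is \<open>y = \<alpha> + e\<^sup>2 Y\<close>, and the
    factors \<open>e\<close> in the root ratio cancel in \<open>u\<close>. The new error is \<open>e\<^sup>2 Y G / F'\<close> with \<open>G = O(e\<^sup>2)\<close>,
    so second-order expansions of all ingredients give it up to \<open>O(e\<^sup>5)\<close>.\<close>
  define F' where "F' = (\<lambda>x. r x + (x - \<alpha>) * deriv r x)"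
  define Y where "Y = (\<lambda>x. deriv r x * inverse (F' x))"
  define y where "y = (\<lambda>x. \<alpha> + (x - \<alpha>) * ((x - \<alpha>) * Y x))"
  define u where "u = (\<lambda>x. (x - \<alpha>) * (Y x * (r (y x) * inverse (r x))))"
  define G where "G = (\<lambda>x. F' x + (-1) * (r (y x) * P (u x)))"
  \<comment> \<open>\<open>d\<close> stems from the third derivative of \<open>r\<close>. It enters
    only the second-order coefficient of \<open>Y\<close> and drops out of \<open>K\<close>, because
    \<open>G\<close> has no terms below order two.\<close>
  define d where "d = (deriv ^^ 2) (deriv r) \<alpha> / 2"
  define p where "p = (deriv ^^ 2) P 0"
  have jd: "jet2 \<alpha> (deriv r) a (2 * b) d"
    using jet2_smooth[OF smooth_near_deriv[OF r(1)]]
    by (simp add: a_def b_def d_def numeral_2_eq_2)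
  have jF': "jet2 \<alpha> F' 1 (2 * a) (3 * b)"
    unfolding F'_def by (rule jet2_eqI[OF jet2_add[OF jr jet2_mult[OF jet2_diff_id jd]]]) auto
  have jY: "jet2 \<alpha> Y a (2 * b - 2 * a ^ 2) (d - 4 * a * b + a * (4 * a ^ 2 - 3 * b))"
    unfolding Y_def by (rule jet2_eqI[OF jet2_mult[OF jd jet2_inverse[OF jF']]])
      (auto simp: power2_eq_square algebra_simps)
  have jy: "jet2 \<alpha> y \<alpha> 0 a"
    unfolding y_def
    by (rule jet2_eqI[OF jet2_add[OF jet2_const jet2_mult[OF jet2_diff_id jet2_mult[OF jet2_diff_id jY]]]]) auto
  \<comment> \<open>\<open>y\<close> has no linear term, so the second derivative of
    \<open>r\<close> does not contribute at this order.\<close>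
  have jry: "jet2 \<alpha> (\<lambda>x. r (y x)) 1 0 (a ^ 2)"
    by (rule jet2_eqI[OF jet2_compose[OF r(1) jy]]) (auto simp: r(2) a_def power2_eq_square)
  have ju: "jet2 \<alpha> u 0 a (2 * b - 3 * a ^ 2)"
    unfolding u_def
    by (rule jet2_eqI[OF jet2_mult[OF jet2_diff_id jet2_mult[OF jY jet2_mult[OF jry jet2_inverse[OF jr]]]]])
       (auto simp: power2_eq_square algebra_simps)
  have jPu: "jet2 \<alpha> (\<lambda>x. P (u x)) 1 (2 * a) (4 * b - 6 * a ^ 2 + p / 2 * a ^ 2)"
    by (rule jet2_eqI[OF jet2_compose[OF P(1) ju]]) (auto simp: P p_def algebra_simps)
  \<comment> \<open>This is where the conditions on \<open>P\<close> come from: the constant term is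
    \<open>1 - P 0\<close>, and the linear one is \<open>2 * a - P'(0) * a\<close>, as
    \<open>u\<close> starts with \<open>a * (x - \<alpha>)\<close> and \<open>r (y x)\<close> has no
    linear term.\<close>
  have jG: "jet2 \<alpha> G 0 0 (5 * a ^ 2 - b - p / 2 * a ^ 2)"
    unfolding G_def
    by (rule jet2_eqI[OF jet2_add[OF jF' jet2_mult[OF jet2_const jet2_mult[OF jry jPu]]]])
       (auto simp: algebra_simps)
  \<comment> \<open>The summand \<open>m\<close> in \<open>9 + m\<close> compensates the term
    \<open>m * (m - 1) / 2 * a ^ 2\<close> of \<open>C_2\<close>. What remains is
    \<open>10 - P''(0)\<close>, and all powers of \<open>m\<close> cancel.\<close>
  have "K = a * (5 * a ^ 2 - b - p / 2 * a ^ 2)"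
    unfolding K_def Ca Cb M_def[symmetric] p_def[symmetric] using M
    by (simp add: field_simps power2_eq_square power3_eq_cube)
  then have jT: "jet2 \<alpha> (\<lambda>x. Y x * (G x * inverse (F' x))) 0 0 K"
    by (intro jet2_eqI[OF jet2_mult[OF jY jet2_mult[OF jG jet2_inverse[OF jF']]]]) auto

  \<comment> \<open>The step as a map of the current iterate alone, so that a single remainder
    function serves all sequences and all indices.\<close>
  define T where "T = (\<lambda>x. let y' = x - of_nat m * (f x / deriv f x); u' = root_ratio f \<alpha> m y' x
     in y' - of_nat m * u' * P u' * (f x / deriv f x))"
  have f_root: "\<forall>\<^sub>F x in nhds \<alpha>. f x = c * ((x - \<alpha>) * r x) ^ m"
    using f_eq r_pow by eventually_elim (use c0 in \<open>simp add: power_mult_distrib\<close>)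
  have nz: "\<forall>\<^sub>F x in nhds \<alpha>. r x \<noteq> 0" "\<forall>\<^sub>F x in nhds \<alpha>. F' x \<noteq> 0"
    using jet2_tendsto[OF jr] jet2_tendsto[OF jF'] by (auto intro: tendsto_imp_eventually_ne)
  have T_eq: "\<forall>\<^sub>F x in nhds \<alpha>. x \<noteq> \<alpha> \<longrightarrow> T x - \<alpha> = (x - \<alpha>) ^ 2 * (Y x * (G x * inverse (F' x)))"
    \<comment> \<open>Besides the equation at \<open>x\<close>, the nested form supplies it on a
      whole neighbourhood of \<open>x\<close>, which is what computing \<open>deriv f x\<close>
      requires.\<close>
    using f_root[THEN eventually_eventually[THEN iffD2]] f_root nz smooth_near_eventually_deriv[OF r(1)]
  proof eventually_elim
    case (elim x)
    show ?case
    proof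
      assume x: "x \<noteq> \<alpha>"
      obtain n where n: "m = Suc n" using m by (cases m) auto
      define e where "e = x - \<alpha>"
      have e: "e \<noteq> 0" using x by (simp add: e_def)
      have F: "((\<lambda>x. (x - \<alpha>) * r x) has_field_derivative F' x) (at x)"
        unfolding F'_def using elim(5) by (auto intro!: derivative_eq_intros)
      have "((\<lambda>x. c * ((x - \<alpha>) * r x) ^ m) has_field_derivative
              c * (of_nat m * (e * r x) ^ n * F' x)) (at x)"
        by (rule derivative_eq_intros refl F)+ (simp add: e_def n del: of_nat_Suc)
      then have "deriv (\<lambda>x. c * ((x - \<alpha>) * r x) ^ m) x = c * (of_nat m * (e * r x) ^ n * F' x)"
        by (rule DERIV_imp_deriv)
      then have df: "deriv f x = c * (M * (e * r x) ^ n * F' x)"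
        using deriv_cong_ev[OF elim(1) refl] by (simp add: M_def)
      have step: "M * (f x / deriv f x) = e * r x * inverse (F' x)"
        unfolding df elim(2) using c0 M e elim(3,4) by (simp add: n e_def[symmetric] field_simps)
      have y': "x - M * (f x / deriv f x) = y x"
      proof -
        have "x - M * (f x / deriv f x) = \<alpha> + e * (F' x - r x) * inverse (F' x)"
          unfolding step using elim(4) by (simp add: e_def field_simps)
        also have "F' x - r x = e * deriv r x" by (simp add: F'_def e_def)
        finally show ?thesis by (simp add: y_def Y_def e_def mult_ac)
      qed
      define Z where "Z = r (y x)"
      have ya: "y x - \<alpha> = e * (e * Y x)" by (simp add: y_def e_def)
      have ux: "u x = e * (Y x * (Z * inverse (r x)))" by (simp add: u_def Z_def e_def)
      have u': "root_ratio f \<alpha> m (y x) x = u x"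
        unfolding root_ratio_def r_def[symmetric] ux ya e_def[symmetric] Z_def[symmetric]
        using e elim(3) by (simp add: divide_simps)
      have "T x = y x - u x * P (u x) * (M * (f x / deriv f x))"
        unfolding T_def Let_def M_def[symmetric] y' u' by simp
      then have "T x - \<alpha> = e * (e * Y x) - u x * P (u x) * (M * (f x / deriv f x))"
        by (simp flip: ya)
      \<comment> \<open>The factor \<open>r x\<close> of the Newton step cancels
        \<open>inverse (r x)\<close> in \<open>u x\<close>, leaving
        \<open>e ^ 2 * Y x * (1 - r (y x) * P (u x) / F' x)\<close>.\<close>
      also have "\<dots> = e ^ 2 * (Y x * (G x * inverse (F' x)))"
        unfolding step G_def Z_def[symmetric] using elim(3,4)
        by (subst (1) ux) (simp add: field_simps power2_eq_square)
      finally show "T x - \<alpha> = (x - \<alpha>) ^ 2 * (Y x * (G x * inverse (F' x)))"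
        by (simp add: e_def)
    qed
  qed
  obtain w where w: "w \<in> O[nhds \<alpha>](\<lambda>_. 1)"
    "\<forall>\<^sub>F x in nhds \<alpha>. Y x * (G x * inverse (F' x)) = K * (x - \<alpha>) ^ 2 + (x - \<alpha>) ^ 3 * w x"
    using jT by (auto simp: jet2_def)
  \<comment> \<open>Taken as the exact difference, so the error formula holds at every iterate;
    closeness to \<open>\<alpha>\<close> matters only for the bound on \<open>R\<close>.\<close>
  define R where "R = (\<lambda>x. T x - \<alpha> - K * (x - \<alpha>) ^ 4)"
  have "at \<alpha> \<le> nhds \<alpha>" by (simp add: at_within_def)
  with w(1) have "w \<in> O[at \<alpha>](\<lambda>_. 1)" by (rule landau_o.big.filter_mono[rotated])
  then have "(\<lambda>x. (x - \<alpha>) ^ 5 * w x) \<in> O[at \<alpha>](\<lambda>x. (x - \<alpha>) ^ 5 * 1)"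
    by (rule landau_o.big.mult[OF landau_o.big_refl])
  moreover have "\<forall>\<^sub>F x in at \<alpha>. R x = (x - \<alpha>) ^ 5 * w x"
    unfolding eventually_at_filter using T_eq w(2)
  proof eventually_elim
    case (elim x)
    show ?case
    proof (intro impI)
      assume "x \<noteq> \<alpha>"
      define e where "e = x - \<alpha>"
      have "T x - \<alpha> = e ^ 2 * (K * e ^ 2 + e ^ 3 * w x)"
        using elim \<open>x \<noteq> \<alpha>\<close> by (simp add: e_def)
      also have "\<dots> = K * e ^ 4 + e ^ 5 * w x"
        by (simp add: distrib_left mult_ac flip: power_add)
      finally show "R x = (x - \<alpha>) ^ 5 * w x"
        by (simp add: R_def e_def)
    qed
  qed
  ultimately have R: "R \<in> O[at \<alpha>](\<lambda>x. (x - \<alpha>) ^ 5)"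
    by (simp add: landau_o.big.in_cong)
  have T: "x (Suc k) - \<alpha> = K * (x k - \<alpha>) ^ 4 + R (x k)" if "two_point_iteration f \<alpha> m P x y u" for x y u k
    using that by (simp add: two_point_iteration_def R_def T_def Let_def)
  have "(\<lambda>x. (x - \<alpha>) ^ 4 * (x - \<alpha>)) \<in> O[at \<alpha>](\<lambda>x. (x - \<alpha>) ^ 4 * 1)"
    using landau_o.big.filter_mono[OF \<open>at \<alpha> \<le> nhds \<alpha>\<close> diff_bigo_1]
    by (rule landau_o.big.mult[OF landau_o.big_refl])
  then have "R \<in> O[at \<alpha>](\<lambda>x. (x - \<alpha>) ^ 4)"
    by (intro landau_o.big_trans[OF R]) (simp add: eval_nat_numeral mult_ac)
  then have "(\<lambda>x. K * (x - \<alpha>) ^ 4 + R x) \<in> O[at \<alpha>](\<lambda>x. (x - \<alpha>) ^ 4)"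
    by (intro sum_in_bigo) simp_all
  with T have "iteration_order f \<alpha> m P 4"
    unfolding iteration_order_def by (intro bexI[of _ "\<lambda>x. K * (x - \<alpha>) ^ 4 + R x"]) blast+
  with T R show ?thesis by blast
qed

section \<open>Roots near 1, and the real and complex cases\<close>

lemma real_root_near_1:
  assumes "m \<ge> 1"
  shows "\<forall>\<^sub>F z in nhds (1::real). exp (ln z / of_nat m) ^ m = z \<and>
     ((\<lambda>z. exp (ln z / of_nat m)) has_field_derivative exp (ln z / of_nat m) / (of_nat m * z)) (at z)"
proof -
  have "\<forall>\<^sub>F z in nhds (1::real). z > 0"
    using eventually_nhds_in_open[of "{0<..}" "1::real"] by simp
  then show ?thesis
  proof eventually_elim
    case (elim z)
    then show ?case using assms
      by (auto simp flip: exp_of_nat_mult intro!: derivative_eq_intros)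
  qed
qed

text \<open>Near 1 the argument avoids the branch cut of \<open>ln\<close>, so the principal root is
  differentiable there.\<close>

lemma complex_root_near_1:
  assumes "m \<ge> 1"
  shows "\<forall>\<^sub>F z in nhds (1::complex). exp (ln z / of_nat m) ^ m = z \<and>
     ((\<lambda>z. exp (ln z / of_nat m)) has_field_derivative exp (ln z / of_nat m) / (of_nat m * z)) (at z)"
proof -
  have "\<forall>\<^sub>F z in nhds (1::complex). z \<in> - \<real>\<^sub>\<le>\<^sub>0"
    by (rule eventually_nhds_in_open) auto
  then show ?thesis
  proof eventually_elim
    case (elim z)
    then have "z \<noteq> 0" by auto
    with elim show ?case using assms
      by (auto simp: field_simps simp flip: exp_of_nat_mult intro!: derivative_eq_intros)
  qed
qed

lemma analytic_at_imp_smooth_near: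
  assumes "f analytic_on {a}"
  shows "smooth_near f a"
proof -
  obtain S where S: "open S" "a \<in> S" "f holomorphic_on S"
    using assms by (auto simp: analytic_at)
  then show ?thesis
    unfolding smooth_near_def
    by (intro exI[of _ S] conjI allI ballI)
       (auto intro: holomorphic_on_imp_differentiable_at[OF holomorphic_higher_deriv])
qed

theorem mainTheorem3:
  fixes m :: nat
  assumes "m \<ge> 1"
  shows
    "(\<forall>(f :: real \<Rightarrow> real) P \<alpha>.
       smooth_near f \<alpha> \<and> zero_of_multiplicity f \<alpha> m \<and>
       smooth_near P 0 \<and> P 0 = 1 \<and> deriv P 0 = 2 \<longrightarrow>
         iteration_order f \<alpha> m P 4 \<and>
         (\<exists>R \<in> O[at \<alpha>](\<lambda>t. (t - \<alpha>) ^ 5).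
            \<forall>x y u. two_point_iteration f \<alpha> m P x y u \<longrightarrow>
              (\<forall>k. f (x k) \<noteq> 0 \<longrightarrow>
                 x (Suc k) - \<alpha> =
                   (- 2 * of_nat m * C_coeff f \<alpha> m 1 * C_coeff f \<alpha> m 2
                     + C_coeff f \<alpha> m 1 ^ 3 * (9 + of_nat m - (deriv ^^ 2) P 0))
                   / (2 * of_nat m ^ 3) * (x k - \<alpha>) ^ 4 + R (x k))))
     \<and>
     (\<forall>(f :: complex \<Rightarrow> complex) P \<alpha>.
       f analytic_on {\<alpha>} \<and> zero_of_multiplicity f \<alpha> m \<and>
       P analytic_on {0} \<and> P 0 = 1 \<and> deriv P 0 = 2 \<longrightarrow>
         iteration_order f \<alpha> m P 4 \<and>
         (\<exists>R \<in> O[at \<alpha>](\<lambda>t. (t - \<alpha>) ^ 5).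
            \<forall>x y u. two_point_iteration f \<alpha> m P x y u \<longrightarrow>
              (\<forall>k. f (x k) \<noteq> 0 \<longrightarrow>
                 x (Suc k) - \<alpha> =
                   (- 2 * of_nat m * C_coeff f \<alpha> m 1 * C_coeff f \<alpha> m 2
                     + C_coeff f \<alpha> m 1 ^ 3 * (9 + of_nat m - (deriv ^^ 2) P 0))
                   / (2 * of_nat m ^ 3) * (x k - \<alpha>) ^ 4 + R (x k))))"
proof ((rule conjI; intro allI impI; elim conjE), goal_cases)
  case (1 f P \<alpha>)
  show ?case
    by (rule two_point_iteration_expansion[OF assms 1 real_root_near_1[OF assms]]) simp
next
  case (2 f P \<alpha>)
  show ?case
    by (rule two_point_iteration_expansion[OF assms analytic_at_imp_smooth_near[OF 2(1)] 2(2)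
          analytic_at_imp_smooth_near[OF 2(3)] 2(4,5) complex_root_near_1[OF assms]]) simp
qed

end
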